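(* Let $A\in\mathbb{R}^{d\times n}$ be such that $\rho_A^+>0$, let $c\in\mathbb{R}^n$, and let $S=\{y\in\mathbb{R}^d : A^Ty\ge c\}$. Then for all $w\in\mathbb{R}^d$, $$\mathrm{dist}(w,S)\le\frac{\|[A^Tw-c]^-\|_\infty}{\rho_A^+},$$ where $\mathrm{dist}(w,S)=\inf_{y\in S}\|w-y\|_2$ is the Euclidean distance from $w$ to $S$, and for a vector $x$ the vector $x^-$ has entries $(x^-)_i=\min\{x_i,0\}$.
   Context: $\mathrm{lin}(A)=\{A\alpha:\alpha\in\mathbb{R}^n\}\subseteq\mathbb{R}^d$ is the linear span of the columns of $A$; $\triangle=\{p\in\mathbb{R}^n: p\ge\mathbf{0},\ \|p\|_1=1\}$ is the probability simplex; $\|\cdot\|$ is the Euclidean norm; vector inequalities are componentwise. The affine-margin of $A$ is $\rho_A:=\sup\{\inf_{p\in\triangle}w^TAp : w\in\mathrm{lin}(A),\ \|w\|=1\}$, and $\rho_A^+:=\max\{0,\rho_A\}$. *)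

theory Defs
  imports "HOL-Analysis.Analysis"
begin

definition lin :: "real^'n^'d \<Rightarrow> (real^'d) set" where
  "lin A = {A *v \<alpha> | \<alpha>. True}"

definition l1norm :: "real^'n \<Rightarrow> real" where
  "l1norm p = (\<Sum>i\<in>UNIV. \<bar>p $ i\<bar>)"

text \<open>The order on vectors is the library's componentwise order.\<close>

definition prob_simplex :: "(real^'n) set" where
  "prob_simplex = {p. p \<ge> 0 \<and> l1norm p = 1}"

text \<open>The supremum is taken in the extended reals. For \<open>A = 0\<close> there is no unit vector in
  \<open>lin A\<close>, so the margin is \<open>-\<infinity>\<close> and its positive part is \<open>0\<close>; a real-valued supremum
  of the empty set would be unspecified.\<close>

definition affine_margin :: "real^'n^'d \<Rightarrow> ereal" where
  "affine_margin A =
     (SUP w\<in>{w. w \<in> lin A \<and> norm w = 1}. INF p\<in>prob_simplex. ereal (w \<bullet> (A *v p)))"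

definition affine_margin_pos :: "real^'n^'d \<Rightarrow> ereal" where
  "affine_margin_pos A = max 0 (affine_margin A)"

text \<open>Unlike \<^const>\<open>infdist\<close>, the distance to the empty set is \<open>\<infinity>\<close> (not \<open>0\<close>), so a finite
  upper bound on the distance includes nonemptiness of the set.\<close>

definition dist_set :: "real^'d \<Rightarrow> (real^'d) set \<Rightarrow> ereal" where
  "dist_set w S = (INF y\<in>S. ereal (norm (w - y)))"

text \<open>The negative part keeps its sign: its entries are nonpositive.\<close>

definition neg_part :: "real^'n \<Rightarrow> real^'n" where
  "neg_part x = (\<chi> i. min (x $ i) 0)"

end

theory Submission imports Defs begin

text \<open>A unit vector \<open>u\<close> with \<open>u\<^sup>T A p \<ge> r > 0\<close> on the simplex satisfies \<open>(A\<^sup>T u)\<^sub>i \<ge> r\<close> for every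
  \<open>i\<close>, because the vertices lie in the simplex. Hence moving from \<open>w\<close> in the direction \<open>u\<close> by the
  largest constraint violation divided by \<open>r\<close> reaches the feasible set. Since \<open>r\<close> can be taken
  arbitrarily close to the margin, no maximizer is needed.\<close>

lemma axis_in_prob_simplex: "axis i 1 \<in> prob_simplex"
  by (simp add: prob_simplex_def l1norm_def less_eq_vec_def axis_def if_distrib[of abs] cong: if_cong)

lemma affine_margin_gtD:
  fixes A :: "real^'n^'d"
  assumes "ereal r < affine_margin A"
  obtains u where "norm u = 1" "\<And>i. r \<le> (transpose A *v u) $ i"
proof -
  obtain u where u: "norm u = 1" "ereal r < (INF p\<in>prob_simplex. ereal (u \<bullet> (A *v p)))"
    using assms unfolding affine_margin_def less_SUP_iff by blast
  have "r \<le> (transpose A *v u) $ i" for i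
  proof -
    have "(INF p\<in>prob_simplex. ereal (u \<bullet> (A *v p))) \<le> ereal (u \<bullet> (A *v axis i 1))"
      by (rule INF_lower[OF axis_in_prob_simplex])
    then have "r < u \<bullet> (A *v axis i 1)"
      using u(2) by (metis less_le_trans ereal_less_eq(3) less_ereal.simps(1))
    \<comment> \<open>\<open>A *v axis i 1\<close> is column i of \<open>A\<close>.\<close>
    also have "\<dots> = (transpose A *v u) $ i"
      by (metis dot_lmul_matrix inner_axis inner_real_def mult.right_neutral matrix_transpose_mul
          transpose_matrix_vector inner_commute)
    finally show ?thesis by simp
  qed
  with u(1) show thesis by (rule that)
qed

lemma dist_set_feasible_le:
  fixes A :: "real^'n^'d"
  assumes "ereal r < affine_margin A" "0 < r"
  shows "dist_set w {y. transpose A *v y \<ge> c}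
    \<le> ereal (infnorm (neg_part (transpose A *v w - c)) / r)"
proof -
  let ?x = "transpose A *v w - c"
  define M where "M = infnorm (neg_part ?x)"
  obtain u where u: "norm u = 1" "\<And>i. r \<le> (transpose A *v u) $ i"
    using affine_margin_gtD[OF assms(1)] by blast
  have M0: "0 \<le> M" by (simp add: M_def infnorm_pos_le)
  \<comment> \<open>Each unit of length along \<open>u\<close> raises every constraint value by at
    least \<open>r\<close>, so length \<open>M / r\<close> makes up the largest deficit
    \<open>M\<close>. For feasible \<open>w\<close> this gives \<open>M = 0\<close> and
    \<open>?y = w\<close>.\<close>
  let ?y = "w + (M / r) *\<^sub>R u"
  have "c $ i \<le> (transpose A *v ?y) $ i" for i
  proof -
    have "\<bar>neg_part ?x $ i\<bar> \<le> M"
      unfolding M_def by (rule component_le_infnorm_cart)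
    \<comment> \<open>If constraint i holds at \<open>w\<close>, then \<open>?x $ i\<close> is
      nonnegative; otherwise it equals its negative part.\<close>
    then have "- M \<le> ?x $ i" by (simp add: neg_part_def min_def split: if_splits)
    moreover have "M \<le> (M / r) * (transpose A *v u) $ i"
      using mult_left_mono[OF u(2)[of i], of "M / r"] M0 assms(2) by simp
    ultimately show ?thesis
      by (simp add: matrix_vector_right_distrib scaleR_matrix_vector_assoc[symmetric]
          matrix_vector_mult_scaleR)
  qed
  then have "?y \<in> {y. transpose A *v y \<ge> c}" by (simp add: less_eq_vec_def)
  then have "dist_set w {y. transpose A *v y \<ge> c} \<le> ereal (norm (w - ?y))"
    unfolding dist_set_def by (rule INF_lower)
  also have "norm (w - ?y) = M / r" using u(1) M0 assms(2) by simp
  finally show ?thesis by (simp add: M_def)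
qed

text \<open>This stands in for the limit of \<open>M / r\<close> as \<open>r\<close> tends to
  \<open>\<rho>\<close>. For positive \<open>D\<close> the bounds cap \<open>\<rho>\<close> by
  \<open>M / D\<close>; thus an infinite \<open>\<rho>\<close> forces
  \<open>D \<le> 0\<close>.\<close>

lemma ereal_le_divide_if_le_all_below:
  fixes D \<rho> :: ereal and M :: real
  assumes "0 < \<rho>" "0 \<le> M"
    and le: "\<And>r. 0 < r \<Longrightarrow> ereal r < \<rho> \<Longrightarrow> D \<le> ereal (M / r)"
  shows "D \<le> ereal M / \<rho>"
proof (cases "D \<le> 0")
  case True
  also have "0 \<le> ereal M / \<rho>" using assms by simp
  finally show ?thesis .
next
  case False
  \<comment> \<open>One admissible \<open>r\<close> already makes \<open>D\<close> finite.\<close>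
  obtain r where r: "0 < r" "ereal r < \<rho>"
    using ereal_dense2[OF assms(1)] by auto
  from le[OF r] False obtain d where d: "D = ereal d" "0 < d"
    by (cases D) auto
  have "\<rho> \<le> ereal (M / d)"
  proof (rule ccontr)
    assume "\<not> \<rho> \<le> ereal (M / d)"
    \<comment> \<open>Such a \<open>t\<close> is admissible, but \<open>d \<le> M / t\<close> would
      mean \<open>t \<le> M / d\<close>.\<close>
    then obtain t where t: "M / d < t" "ereal t < \<rho>"
      using ereal_dense2[of "ereal (M / d)" \<rho>] by (auto simp: not_le)
    have "0 \<le> M / d" using assms(2) d(2) by simp
    with t(1) have "0 < t" by linarith
    with le[of t] t d show False by (simp add: field_simps)
  qed
  with assms(1) obtain R where R: "\<rho> = ereal R" "0 < R" "R \<le> M / d"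
    by (cases \<rho>) auto
  with d show ?thesis by (simp add: field_simps)
qed

theorem theorem3:
  fixes A :: "real^'n^'d" and c :: "real^'n" and S :: "(real^'d) set"
  assumes "affine_margin_pos A > 0"
    and "S = {y. transpose A *v y \<ge> c}"
  shows "\<forall>w. dist_set w S \<le> ereal (infnorm (neg_part (transpose A *v w - c))) / affine_margin_pos A"
proof
  fix w
  \<comment> \<open>A positive maximum with 0 is attained by the margin.\<close>
  have pos: "affine_margin_pos A = affine_margin A"
    using assms(1) by (auto simp: affine_margin_pos_def max_def split: if_splits)
  show "dist_set w S \<le> ereal (infnorm (neg_part (transpose A *v w - c))) / affine_margin_pos A"
    using assms(1) unfolding pos assms(2)
    by (intro ereal_le_divide_if_le_all_below infnorm_pos_le dist_set_feasible_le)
qed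

end
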